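(* Fix a real $\gamma\in(0,1)$ and a real $\alpha$ satisfying $$0<\alpha<\frac{\gamma\tau}{\sqrt{1+2\tau^2}}\cdot\frac{\mu}{\rho}.$$ Let $x_0\in\mathcal{T}_\gamma$ and let $\{x_k\}$ be any sequence of iterates generated by the subgradient method with constant stepsize $\alpha$ initialized at $x_0$: at step $k\ge0$, choose any $\zeta_k\in\partial g(x_k)$; if $\zeta_k=0$, the algorithm stops; otherwise set $x_{k+1}=\mathrm{proj}_{\mathcal{X}}\left(x_k-\alpha\frac{\zeta_k}{\|\zeta_k\|}\right)$. Write $E_k:=\mathrm{dist}^2(x_k;\mathcal{X}^* )$ and define $$E^*:=\left(\frac{\alpha L}{\mu+\sqrt{\mu^2-\alpha\rho L}}\right)^2,\qquad D:=\sqrt{\max\{E_0,\,2\alpha^2+E^*\}}.$$ Then for each index $k$ for which $x_k$ is generated, the estimates hold: $$\sqrt{E_k}\le D\le\frac{\gamma\mu}{\rho}\qquad\text{and}\qquad E_k-E^*\le\max\left\{q^k(E_0-E^* ),\,2\alpha^2\right\},$$ where the coefficient $q:=1+\frac{\alpha}{L}\left(\rho-\frac{\mu}{D}\right)$ satisfies $q\in(0,1)$.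
   Context: $\mathbb{R}^d$ carries the Euclidean inner product and norm. For a set $\mathcal{Y}$, $\mathrm{dist}(y;\mathcal{Y})=\inf_{x\in\mathcal{Y}}\|y-x\|$, and $\mathrm{proj}_{\mathcal{Y}}(y)$ is the set of nearest points of $\mathcal{Y}$ to $y$ (a single point when $\mathcal{Y}$ is nonempty, closed and convex). Standing setting: consider $\min_{x\in\mathcal{X}}g(x)$, with fixed reals $\mu,\rho>0$, such that: (1) $g:\mathbb{R}^d\to\mathbb{R}$ is $\rho$-weakly convex, i.e. $x\mapsto g(x)+\frac{\rho}{2}\|x\|^2$ is convex; $\mathcal{X}\subset\mathbb{R}^d$ is closed and convex; and the set of minimizers $\mathcal{X}^*:=\mathrm{argmin}_{x\in\mathcal{X}}g(x)$ is nonempty. (2) (Sharpness) $g(x)-\min_{\mathcal{X}}g\ge\mu\cdot\mathrm{dist}(x;\mathcal{X}^* )$ for all $x\in\mathcal{X}$. The subdifferential $\partial g(x)$ is the set of all $v\in\mathbb{R}^d$ with $g(y)\ge g(x)+\langle v,y-x\rangle+o(\|y-x\|)$ as $y\to x$; for $\rho$-weakly convex $g$ this is equivalent to $g(y)\ge g(x)+\langle v,y-x\rangle-\frac{\rho}{2}\|y-x\|^2$ for all $y\in\mathbb{R}^d$. For $\gamma>0$, $\mathcal{T}_\gamma:=\{x\in\mathcal{X}:\mathrm{dist}(x;\mathcal{X}^* )<\gamma\mu/\rho\}$. Set $L:=\sup\{\|\zeta\|:\zeta\in\partial g(x),\ x\in\mathcal{T}_1\}$ and $\tau:=\mu/L$,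 where $\tau\in[0,1]$ (with $\tau=0$ if $L=+\infty$; the hypothesis on $\alpha$ forces $\tau>0$, i.e. $L<\infty$). *)

theory Defs
  imports "HOL-Analysis.Analysis" "HOL-Library.Landau_Symbols"
begin

definition weakly_convex :: "real \<Rightarrow> ('a::euclidean_space \<Rightarrow> real) \<Rightarrow> bool" where
  "weakly_convex \<rho> g \<longleftrightarrow> convex_on UNIV (\<lambda>x. g x + \<rho> / 2 * (norm x)\<^sup>2)"

definition minimizers :: "('a \<Rightarrow> real) \<Rightarrow> 'a set \<Rightarrow> 'a set" where
  "minimizers g X = {x. is_arg_min g (\<lambda>y. y \<in> X) x}"

text \<open>The infimum below is the minimum of \<open>g\<close> over \<open>X\<close> as soon as \<open>minimizers g X\<close> is nonempty;
  otherwise it and \<open>infdist\<close> to the empty set are meaningless.\<close>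

definition sharp :: "real \<Rightarrow> ('a::euclidean_space \<Rightarrow> real) \<Rightarrow> 'a set \<Rightarrow> bool" where
  "sharp \<mu> g X \<longleftrightarrow> (\<forall>x\<in>X. g x - (INF y\<in>X. g y) \<ge> \<mu> * infdist x (minimizers g X))"

definition subdifferential :: "('a::euclidean_space \<Rightarrow> real) \<Rightarrow> 'a \<Rightarrow> 'a set" where
  "subdifferential g x =
     {v. \<exists>r \<in> o[at x](\<lambda>y. norm (y - x)). \<forall>\<^sub>F y in at x. g y \<ge> g x + v \<bullet> (y - x) + r y}"

definition tube :: "('a::euclidean_space \<Rightarrow> real) \<Rightarrow> 'a set \<Rightarrow> real \<Rightarrow> real \<Rightarrow> real \<Rightarrow> 'a set" where
  "tube g X \<mu> \<rho> \<gamma> = {x \<in> X. infdist x (minimizers g X) < \<gamma> * \<mu> / \<rho>}"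

text \<open>The supremum may be infinite; division on \<^typ>\<open>ereal\<close> then gives \<open>\<mu> / \<infinity> = 0\<close>, while \<open>\<mu> / 0 = \<infinity>\<close>
  for \<open>\<mu> > 0\<close>.\<close>

definition subgradient_bound ::
  "('a::euclidean_space \<Rightarrow> real) \<Rightarrow> 'a set \<Rightarrow> real \<Rightarrow> real \<Rightarrow> ereal" where
  "subgradient_bound g X \<mu> \<rho> =
     Sup {ereal (norm \<zeta>) | \<zeta> x. \<zeta> \<in> subdifferential g x \<and> x \<in> tube g X \<mu> \<rho> 1}"

text \<open>The method stops at the first index \<open>k\<close> with \<open>\<zeta> k = 0\<close>. The sequences \<open>x\<close> and \<open>\<zeta>\<close> are total
  functions whose values after stopping are unconstrained; \<open>generated \<zeta> k\<close> says that the method has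
  not stopped before producing \<open>x k\<close>.\<close>

definition generated :: "(nat \<Rightarrow> 'a::euclidean_space) \<Rightarrow> nat \<Rightarrow> bool" where
  "generated \<zeta> k \<longleftrightarrow> (\<forall>j<k. \<zeta> j \<noteq> 0)"

definition subgradient_method ::
  "('a::euclidean_space \<Rightarrow> real) \<Rightarrow> 'a set \<Rightarrow> real \<Rightarrow> (nat \<Rightarrow> 'a) \<Rightarrow> (nat \<Rightarrow> 'a) \<Rightarrow> bool" where
  "subgradient_method g X \<alpha> x \<zeta> \<longleftrightarrow>
     (\<forall>k. generated \<zeta> k \<longrightarrow>
        \<zeta> k \<in> subdifferential g (x k) \<and>
        (\<zeta> k \<noteq> 0 \<longrightarrow> x (Suc k) = closest_point X (x k - \<alpha> *\<^sub>R (\<zeta> k /\<^sub>R norm (\<zeta> k)))))"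

end

theory Submission
  imports Defs
begin

text \<open>
  Write \<open>d\<close> for the distance of an iterate to the set of minimizers. Weak convexity turns a local
  subgradient into a global one up to the error \<open>\<rho>/2 * norm (y - x)^2\<close>
  (\<open>subgradient_quadratic_minorant\<close>). Testing this at the minimizer closest to the iterate and
  inserting sharpness gives \<open>\<zeta> \<bullet> (x - p) \<ge> \<mu> d - \<rho>/2 d^2\<close>, which is nonnegative inside the tube.
  Since projecting onto \<open>X\<close> does not increase the distance to a minimizer, expanding the square
  yields the scalar recursion
  \<open>d_next^2 \<le> d^2 + \<alpha>^2 - 2 \<alpha>/L (\<mu> d - \<rho>/2 d^2)\<close> (\<open>subgradient_step_distance\<close>).

  The right-hand side, as a function of \<open>d\<close>, has the fixed point
  \<open>s = \<alpha> L / (\<mu> + sqrt (\<mu>^2 - \<alpha> \<rho> L))\<close>, the smaller root of \<open>\<rho> s^2 - 2 \<mu> s + \<alpha> L = 0\<close>. Subtracting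
  the fixed point equation, the excess \<open>d^2 - s^2\<close> is multiplied by
  \<open>1 + \<alpha>/L (\<rho> - 2 \<mu>/(d + s))\<close>. Above the fixed point this is at most \<open>q\<close>, as \<open>d + s \<le> 2 D\<close>
  (\<open>recursion_contracts\<close>); below it, the new excess is at most the \<open>\<alpha>^2\<close> contributed by the step
  length (\<open>recursion_below_fixed_point\<close>). In either case the iterate remains within distance \<open>D\<close> of
  the minimizers, hence in the tube, which keeps the induction going.
  The bound on \<open>\<alpha>\<close> is exactly what makes \<open>2 \<alpha>^2 + \<alpha>^2/\<tau>^2 < (\<gamma> \<mu>/\<rho>)^2\<close>, hence
  \<open>D \<le> \<gamma> \<mu>/\<rho>\<close> (\<open>noise_floor_in_tube\<close>).
\<close>

section \<open>Weakly convex functions and sharp minima\<close>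

text \<open>A convex function lies below its chord, so the slope of \<open>g + \<rho>/2 * norm^2\<close> from \<open>x\<close> towards
  \<open>y\<close> at a small distance is at most the slope of the whole segment; the little-o error of the
  local inequality disappears relative to the distance.\<close>

lemma subgradient_quadratic_minorant:
  fixes g :: "'a::euclidean_space \<Rightarrow> real"
  assumes "\<rho> \<ge> 0" and wc: "weakly_convex \<rho> g" and v: "v \<in> subdifferential g x"
  shows "g y \<ge> g x + v \<bullet> (y - x) - \<rho> / 2 * (norm (y - x))\<^sup>2"
proof (cases "y = x")
  case False
  define z where "z = y - x"
  have z: "norm z > 0" "y = x + z" using False by (auto simp: z_def)
  obtain r where r: "r \<in> o[at x](\<lambda>y. norm (y - x))"
      and ev: "\<forall>\<^sub>F w in at x. g w \<ge> g x + v \<bullet> (w - x) + r w"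
    using v by (auto simp: subdifferential_def)
  define C where "C = g y - g x - v \<bullet> z + \<rho> / 2 * (norm z)\<^sup>2"
  have approx: "C \<ge> - e * norm z" if e: "e > 0" for e
  proof -
    have "\<forall>\<^sub>F w in at x. norm (r w) \<le> e * norm (norm (w - x))"
      using landau_o.smallD[OF r e] .
    with ev have "\<forall>\<^sub>F w in at x. g w \<ge> g x + v \<bullet> (w - x) - e * norm (w - x)"
      by eventually_elim auto
    then obtain d where d: "d > 0"
        "\<And>w. w \<noteq> x \<Longrightarrow> dist w x < d \<Longrightarrow> g w \<ge> g x + v \<bullet> (w - x) - e * norm (w - x)"
      by (auto simp: eventually_at)
    define s where "s = min 1 (d / (2 * norm z))"
    have s: "0 < s" "s \<le> 1" "s * norm z < d"
    proof -
      show "0 < s" "s \<le> 1" using d z by (auto simp: s_def)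
      have "s * norm z \<le> d / (2 * norm z) * norm z"
        unfolding s_def by (intro mult_right_mono) auto
      also have "\<dots> < d" using d z by simp
      finally show "s * norm z < d" .
    qed
    have low: "g (x + s *\<^sub>R z) \<ge> g x + s * (v \<bullet> z) - e * (s * norm z)"
      using d(2)[of "x + s *\<^sub>R z"] s z by (auto simp: dist_norm)
    have "(\<lambda>x. g x + \<rho> / 2 * (norm x)\<^sup>2) ((1 - s) *\<^sub>R x + s *\<^sub>R y)
        \<le> (1 - s) * (g x + \<rho> / 2 * (norm x)\<^sup>2) + s * (g y + \<rho> / 2 * (norm y)\<^sup>2)"
      using wc s unfolding weakly_convex_def by (intro convex_onD) auto
    moreover have "(1 - s) *\<^sub>R x + s *\<^sub>R y = x + s *\<^sub>R z"
      by (simp add: z_def algebra_simps)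
    ultimately have up: "g (x + s *\<^sub>R z) + \<rho> / 2 * (norm (x + s *\<^sub>R z))\<^sup>2
        \<le> (1 - s) * (g x + \<rho> / 2 * (norm x)\<^sup>2) + s * (g y + \<rho> / 2 * (norm y)\<^sup>2)"
      by simp
    have n1: "(norm (x + s *\<^sub>R z))\<^sup>2 = (norm x)\<^sup>2 + 2 * s * (x \<bullet> z) + s\<^sup>2 * (norm z)\<^sup>2"
      unfolding power2_norm_eq_inner
      by (simp add: algebra_simps power2_eq_square inner_commute)
    have n2: "(norm y)\<^sup>2 = (norm x)\<^sup>2 + 2 * (x \<bullet> z) + (norm z)\<^sup>2"
      unfolding power2_norm_eq_inner z(2)
      by (simp add: algebra_simps inner_commute)
    have "s * (C + e * norm z) \<ge> \<rho> / 2 * s\<^sup>2 * (norm z)\<^sup>2"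
      using low up unfolding n1 n2 C_def
      by (simp add: algebra_simps add_divide_distrib diff_divide_distrib)
    moreover have "\<rho> / 2 * s\<^sup>2 * (norm z)\<^sup>2 \<ge> 0" using \<open>\<rho> \<ge> 0\<close> by simp
    ultimately have "s * (C + e * norm z) \<ge> 0" by linarith
    then show ?thesis using s(1) by (simp add: zero_le_mult_iff)
  qed
  have "C \<ge> 0"
  proof (rule ccontr)
    assume "\<not> C \<ge> 0"
    then show False using approx[of "- C / (2 * norm z)"] z(1) by (simp add: field_simps)
  qed
  then show ?thesis by (simp add: C_def z_def)
qed simp

lemma continuous_on_weakly_convex:
  fixes g :: "'a::euclidean_space \<Rightarrow> real"
  assumes "weakly_convex \<rho> g"
  shows "continuous_on UNIV g"
proof -
  have "continuous_on UNIV (\<lambda>x. g x + \<rho> / 2 * (norm x)\<^sup>2)"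
    using assms unfolding weakly_convex_def by (intro convex_on_continuous) auto
  then have "continuous_on UNIV (\<lambda>x. (g x + \<rho> / 2 * (norm x)\<^sup>2) - \<rho> / 2 * (norm x)\<^sup>2)"
    by (rule continuous_on_diff) (intro continuous_intros)
  then show ?thesis by simp
qed

lemma closed_minimizers:
  fixes g :: "'a::topological_space \<Rightarrow> real"
  assumes "continuous_on UNIV g" and "closed X"
  shows "closed (minimizers g X)"
proof (cases "minimizers g X = {}")
  case False
  then obtain p where p: "p \<in> X" "\<And>y. y \<in> X \<Longrightarrow> g p \<le> g y"
    by (auto simp: minimizers_def is_arg_min_linorder)
  have "minimizers g X = X \<inter> {y. g y \<le> g p}"
    using p by (auto simp: minimizers_def is_arg_min_linorder dest: order_trans)
  moreover have "closed {y. g y \<le> g p}"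
    using assms(1) by (intro closed_Collect_le continuous_intros)
  ultimately show ?thesis using assms(2) by auto
qed simp

lemma sharp_at_minimizer:
  assumes "sharp \<mu> g X" and p: "p \<in> minimizers g X" and "x \<in> X"
  shows "g x - g p \<ge> \<mu> * infdist x (minimizers g X)"
proof -
  have "(INF y\<in>X. g y) = g p"
    using p by (intro cInf_eq_minimum) (auto simp: minimizers_def is_arg_min_linorder)
  then show ?thesis using assms(1,3) by (auto simp: sharp_def)
qed

section \<open>One projected subgradient step\<close>

text \<open>All three ingredients meet at the minimizer \<open>p\<close> closest to \<open>x\<close>. The hypothesis
  \<open>\<rho> * d \<le> 2 * \<mu>\<close> makes the decrease nonnegative, which is needed to replace the unknown
  \<open>norm \<zeta>\<close> in its denominator by the upper bound \<open>l\<close>.\<close>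

lemma subgradient_step_distance:
  fixes g :: "'a::euclidean_space \<Rightarrow> real" and X :: "'a set"
  assumes "\<rho> \<ge> 0" "\<alpha> \<ge> 0" "l > 0"
    and wc: "weakly_convex \<rho> g" and X: "closed X" "convex X"
    and ne: "minimizers g X \<noteq> {}" and "sharp \<mu> g X"
    and x: "x \<in> X" and \<zeta>: "\<zeta> \<in> subdifferential g x" "\<zeta> \<noteq> 0" "norm \<zeta> \<le> l"
    and d: "d = infdist x (minimizers g X)" "\<rho> * d \<le> 2 * \<mu>"
  shows "(infdist (closest_point X (x - \<alpha> *\<^sub>R (\<zeta> /\<^sub>R norm \<zeta>))) (minimizers g X))\<^sup>2
    \<le> d\<^sup>2 + \<alpha>\<^sup>2 - 2 * \<alpha> / l * (\<mu> * d - \<rho> / 2 * d\<^sup>2)"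
proof -
  let ?M = "minimizers g X"
  define u where "u = \<zeta> /\<^sub>R norm \<zeta>"
  have "closed ?M"
    using closed_minimizers continuous_on_weakly_convex[OF wc] X(1) by blast
  then obtain p where p: "p \<in> ?M" and dp: "d = dist x p"
    using infdist_attains_inf[OF _ ne] d(1) by blast
  have pX: "p \<in> X" using p by (auto simp: minimizers_def is_arg_min_linorder)
  have "g p \<ge> g x + \<zeta> \<bullet> (p - x) - \<rho> / 2 * (norm (p - x))\<^sup>2"
    using subgradient_quadratic_minorant[OF \<open>\<rho> \<ge> 0\<close> wc \<zeta>(1)] .
  moreover have "g x - g p \<ge> \<mu> * d"
    using sharp_at_minimizer[OF \<open>sharp \<mu> g X\<close> p x] d(1) by simp
  moreover have "\<zeta> \<bullet> (p - x) = - (\<zeta> \<bullet> (x - p))" by (simp add: inner_diff_right)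
  ultimately have dec: "\<zeta> \<bullet> (x - p) \<ge> \<mu> * d - \<rho> / 2 * d\<^sup>2"
    by (simp add: dp dist_norm norm_minus_commute)
  have "d \<ge> 0" by (simp add: dp)
  have "d * (2 * \<mu> - \<rho> * d) \<ge> 0" using d(2) \<open>d \<ge> 0\<close> by simp
  then have nonneg: "\<mu> * d - \<rho> / 2 * d\<^sup>2 \<ge> 0"
    by (simp add: power2_eq_square algebra_simps)
  have "(\<mu> * d - \<rho> / 2 * d\<^sup>2) / l \<le> (\<zeta> \<bullet> (x - p)) / norm \<zeta>"
    using dec nonneg \<zeta> by (intro frac_le) auto
  also have "\<dots> = u \<bullet> (x - p)" by (simp add: u_def divide_inverse_commute)
  finally have "2 * \<alpha> * ((\<mu> * d - \<rho> / 2 * d\<^sup>2) / l) \<le> 2 * \<alpha> * (u \<bullet> (x - p))"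
    using \<open>\<alpha> \<ge> 0\<close> by (intro mult_left_mono) auto
  moreover have "(norm (x - \<alpha> *\<^sub>R u - p))\<^sup>2 = d\<^sup>2 + \<alpha>\<^sup>2 - 2 * \<alpha> * (u \<bullet> (x - p))"
  proof -
    have "norm u = 1" using \<zeta>(2) by (simp add: u_def)
    then have "u \<bullet> u = 1" by (simp add: norm_eq_1)
    moreover have "x - \<alpha> *\<^sub>R u - p = (x - p) - \<alpha> *\<^sub>R u" by simp
    ultimately show ?thesis
      unfolding dp dist_norm power2_norm_eq_inner
      by (simp add: inner_diff_left inner_diff_right inner_commute power2_eq_square algebra_simps)
  qed
  moreover have "infdist (closest_point X (x - \<alpha> *\<^sub>R u)) ?M \<le> norm (x - \<alpha> *\<^sub>R u - p)"
  proof -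
    have "infdist (closest_point X (x - \<alpha> *\<^sub>R u)) ?M \<le> dist (closest_point X (x - \<alpha> *\<^sub>R u)) p"
      using p by (rule infdist_le)
    also have "\<dots> = dist (closest_point X (x - \<alpha> *\<^sub>R u)) (closest_point X p)"
      using closest_point_self[OF pX] by simp
    also have "\<dots> \<le> dist (x - \<alpha> *\<^sub>R u) p"
      using X x by (intro closest_point_lipschitz) auto
    finally show ?thesis by (simp add: dist_norm)
  qed
  then have "(infdist (closest_point X (x - \<alpha> *\<^sub>R u)) ?M)\<^sup>2 \<le> (norm (x - \<alpha> *\<^sub>R u - p))\<^sup>2"
    by (intro power_mono infdist_nonneg)
  ultimately show ?thesis by (simp add: u_def)
qed

section \<open>The scalar recursion\<close>

text \<open>Rationalizing the denominator identifies \<open>s\<close> with the smaller root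
  \<open>(\<mu> - sqrt (\<mu>^2 - \<alpha> \<rho> l)) / \<rho>\<close>; the form below remains meaningful as \<open>\<rho>\<close> tends to \<open>0\<close>, and
  shows \<open>s \<le> \<alpha> l/\<mu>\<close>.\<close>

lemma fixed_point_equation:
  fixes \<alpha> \<rho> \<mu> l s :: real
  assumes "\<mu> > 0" "\<alpha> * \<rho> * l \<le> \<mu>\<^sup>2"
    and s: "s = \<alpha> * l / (\<mu> + sqrt (\<mu>\<^sup>2 - \<alpha> * \<rho> * l))"
  shows "\<rho> * s\<^sup>2 - 2 * \<mu> * s + \<alpha> * l = 0"
proof -
  define r where "r = sqrt (\<mu>\<^sup>2 - \<alpha> * \<rho> * l)"
  have r: "r \<ge> 0" "r\<^sup>2 = \<mu>\<^sup>2 - \<alpha> * \<rho> * l" using assms(2) by (auto simp: r_def)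
  have "\<mu> + r > 0" using r(1) assms(1) by simp
  then have sr: "s * (\<mu> + r) = \<alpha> * l" unfolding s r_def[symmetric] by simp
  have "(\<mu> + r) * (\<mu> - r) = \<rho> * (\<alpha> * l)"
    using r(2) by (simp add: power2_eq_square algebra_simps)
  then have "(\<mu> + r) * (\<mu> - r) = (\<mu> + r) * (\<rho> * s)"
    using sr by (simp add: algebra_simps)
  then have "r = \<mu> - \<rho> * s" using \<open>\<mu> + r > 0\<close> by simp
  then have "s * (\<mu> + (\<mu> - \<rho> * s)) = \<alpha> * l" using sr by simp
  then show ?thesis by (simp add: power2_eq_square algebra_simps)
qed

text \<open>The fixed point equation lets \<open>\<alpha>^2\<close> be traded for terms in \<open>s\<close>, after which the linear and the
  quadratic part both contain the factor \<open>d - s\<close>. The negative linear part is compared with the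
  quadratic excess \<open>d^2 - s^2 = (d - s) (d + s)\<close> through \<open>d + s \<le> 2 D\<close>.\<close>

lemma recursion_contracts:
  fixes \<alpha> \<rho> \<mu> l s d D q :: real
  assumes fp: "\<rho> * s\<^sup>2 - 2 * \<mu> * s + \<alpha> * l = 0"
    and pos: "\<mu> \<ge> 0" "\<alpha> \<ge> 0" "l > 0" "0 < s" "s \<le> d" "d \<le> D"
    and q: "q = 1 + \<alpha> / l * (\<rho> - \<mu> / D)"
  shows "d\<^sup>2 + \<alpha>\<^sup>2 - 2 * \<alpha> / l * (\<mu> * d - \<rho> / 2 * d\<^sup>2) - s\<^sup>2 \<le> q * (d\<^sup>2 - s\<^sup>2)"
proof -
  have fp': "\<alpha>\<^sup>2 = \<alpha> / l * (2 * \<mu> * s - \<rho> * s\<^sup>2)"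
  proof -
    have "2 * \<mu> * s - \<rho> * s\<^sup>2 = \<alpha> * l" using fp by simp
    then show ?thesis using pos(3) by (simp add: power2_eq_square)
  qed
  have "d\<^sup>2 + \<alpha>\<^sup>2 - 2 * \<alpha> / l * (\<mu> * d - \<rho> / 2 * d\<^sup>2) - s\<^sup>2
      = d\<^sup>2 - s\<^sup>2 + \<alpha> / l * (\<rho> * (d\<^sup>2 - s\<^sup>2) - 2 * \<mu> * (d - s))"
    unfolding fp' by (simp add: algebra_simps add_divide_distrib diff_divide_distrib)
  moreover have "\<mu> / D * (d\<^sup>2 - s\<^sup>2) \<le> 2 * \<mu> * (d - s)"
  proof -
    have "\<mu> / D * (d\<^sup>2 - s\<^sup>2) = \<mu> * (d - s) * ((d + s) / D)"
      by (simp add: power2_eq_square algebra_simps add_divide_distrib diff_divide_distrib)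
    also have "\<dots> \<le> \<mu> * (d - s) * 2"
      using pos by (intro mult_left_mono) (auto simp: divide_simps)
    finally show ?thesis by simp
  qed
  then have "\<alpha> / l * (\<rho> * (d\<^sup>2 - s\<^sup>2) - 2 * \<mu> * (d - s))
      \<le> \<alpha> / l * (\<rho> * (d\<^sup>2 - s\<^sup>2) - \<mu> / D * (d\<^sup>2 - s\<^sup>2))"
    using pos by (intro mult_left_mono) auto
  moreover have "q * (d\<^sup>2 - s\<^sup>2)
      = d\<^sup>2 - s\<^sup>2 + \<alpha> / l * (\<rho> * (d\<^sup>2 - s\<^sup>2) - \<mu> / D * (d\<^sup>2 - s\<^sup>2))"
    unfolding q by (simp add: algebra_simps)
  ultimately show ?thesis by linarith
qed

text \<open>Below the fixed point the excess \<open>d^2 - s^2\<close> is negative and need not contract, but the step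
  can overshoot by at most \<open>\<alpha>^2\<close>: the fixed point equation gives \<open>\<rho> s \<le> 2 \<mu>\<close>, so the decrease
  \<open>\<mu> d - \<rho>/2 d^2\<close> is nonnegative.\<close>

lemma recursion_below_fixed_point:
  fixes \<alpha> \<rho> \<mu> l s d :: real
  assumes fp: "\<rho> * s\<^sup>2 - 2 * \<mu> * s + \<alpha> * l = 0"
    and pos: "\<rho> \<ge> 0" "\<alpha> \<ge> 0" "l > 0" "0 \<le> d" "d < s"
  shows "d\<^sup>2 + \<alpha>\<^sup>2 - 2 * \<alpha> / l * (\<mu> * d - \<rho> / 2 * d\<^sup>2) \<le> s\<^sup>2 + \<alpha>\<^sup>2"
proof -
  have "\<rho> * s \<le> 2 * \<mu>"
  proof -
    have "s * (2 * \<mu> - \<rho> * s) = \<alpha> * l" using fp by (simp add: power2_eq_square algebra_simps)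
    moreover have "\<alpha> * l \<ge> 0" using pos by simp
    ultimately have "s * (2 * \<mu> - \<rho> * s) \<ge> 0" by simp
    then show ?thesis using pos by (auto simp: zero_le_mult_iff)
  qed
  then have "\<rho> * d \<le> 2 * \<mu>"
    using pos mult_left_mono[of d s \<rho>] by linarith
  then have "d * (2 * \<mu> - \<rho> * d) \<ge> 0" using pos by simp
  then have "\<mu> * d - \<rho> / 2 * d\<^sup>2 \<ge> 0" by (simp add: power2_eq_square algebra_simps)
  then have "2 * \<alpha> / l * (\<mu> * d - \<rho> / 2 * d\<^sup>2) \<ge> 0" using pos by simp
  moreover have "d\<^sup>2 \<le> s\<^sup>2" using pos by (intro power_mono) auto
  ultimately show ?thesis by linarith
qed

text \<open>Squared, the step size condition says \<open>2 \<alpha>^2 + \<alpha>^2/\<tau>^2 < c^2\<close>; the second summand is the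
  bound on the squared fixed point obtained by dropping the square root from its denominator.\<close>

lemma noise_floor_in_tube:
  fixes \<alpha> \<tau> c :: real
  assumes "\<tau> > 0" "0 \<le> \<alpha>" and \<alpha>: "\<alpha> < c * \<tau> / sqrt (1 + 2 * \<tau>\<^sup>2)"
  shows "2 * \<alpha>\<^sup>2 + (\<alpha> / \<tau>)\<^sup>2 < c\<^sup>2"
proof -
  have pos: "1 + 2 * \<tau>\<^sup>2 > 0" by (simp add: add_pos_nonneg)
  have "\<alpha> * sqrt (1 + 2 * \<tau>\<^sup>2) < c * \<tau>" using \<alpha> pos by (simp add: pos_less_divide_eq)
  then have "(\<alpha> * sqrt (1 + 2 * \<tau>\<^sup>2))\<^sup>2 < (c * \<tau>)\<^sup>2"
    using assms pos by (intro power_strict_mono) auto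
  then have "\<alpha>\<^sup>2 * (1 + 2 * \<tau>\<^sup>2) < c\<^sup>2 * \<tau>\<^sup>2" using pos by (simp add: power_mult_distrib)
  then have "\<alpha>\<^sup>2 * (1 + 2 * \<tau>\<^sup>2) / \<tau>\<^sup>2 < c\<^sup>2" using assms(1) by (simp add: pos_divide_less_eq)
  moreover have "\<alpha>\<^sup>2 * (1 + 2 * \<tau>\<^sup>2) / \<tau>\<^sup>2 = 2 * \<alpha>\<^sup>2 + (\<alpha> / \<tau>)\<^sup>2"
    using assms(1) by (simp add: field_simps power_divide)
  ultimately show ?thesis by simp
qed

section \<open>Linear convergence up to the noise floor\<close>

theorem theorem4p3:
  fixes g :: "'a::euclidean_space \<Rightarrow> real" and X :: "'a set"
    and \<mu> \<rho> \<gamma> \<alpha> \<tau> D q Estar :: real and L :: ereal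
    and x \<zeta> :: "nat \<Rightarrow> 'a" and E :: "nat \<Rightarrow> real"
  assumes "\<mu> > 0" and "\<rho> > 0"
    and "weakly_convex \<rho> g"
    and "closed X" and "convex X"
    and "minimizers g X \<noteq> {}"
    and "sharp \<mu> g X"
    and "L = subgradient_bound g X \<mu> \<rho>"
    and "ereal \<tau> = ereal \<mu> / L" and "\<tau> \<in> {0..1}"
    and "\<gamma> \<in> {0<..<1}"
    and "0 < \<alpha>" and "\<alpha> < \<gamma> * \<tau> / sqrt (1 + 2 * \<tau>\<^sup>2) * (\<mu> / \<rho>)"
    and "x 0 \<in> tube g X \<mu> \<rho> \<gamma>"
    and "subgradient_method g X \<alpha> x \<zeta>"
    and "\<And>k. E k = (infdist (x k) (minimizers g X))\<^sup>2"
    and "Estar = (\<alpha> * real_of_ereal L /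
                   (\<mu> + sqrt (\<mu>\<^sup>2 - \<alpha> * \<rho> * real_of_ereal L)))\<^sup>2"
    and "D = sqrt (max (E 0) (2 * \<alpha>\<^sup>2 + Estar))"
    and "q = 1 + \<alpha> / real_of_ereal L * (\<rho> - \<mu> / D)"
  shows "q \<in> {0<..<1} \<and>
    (\<forall>k. generated \<zeta> k \<longrightarrow>
       sqrt (E k) \<le> D \<and> D \<le> \<gamma> * \<mu> / \<rho> \<and>
       E k - Estar \<le> max (q ^ k * (E 0 - Estar)) (2 * \<alpha>\<^sup>2))"
proof -
  let ?M = "minimizers g X"
  define l where "l = real_of_ereal L"
  define c where "c = \<gamma> * \<mu> / \<rho>"
  define s where "s = \<alpha> * l / (\<mu> + sqrt (\<mu>\<^sup>2 - \<alpha> * \<rho> * l))"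
  note \<mu> = assms(1) and \<rho> = assms(2) and \<alpha> = assms(12)
  have \<gamma>: "0 < \<gamma>" "\<gamma> < 1" using assms(11) by auto
  have c: "0 < c" "c < \<mu> / \<rho>"
    using \<mu> \<rho> \<gamma> by (auto simp: c_def divide_strict_right_mono)
  have step: "\<alpha> < c * \<tau> / sqrt (1 + 2 * \<tau>\<^sup>2)"
    using assms(13) by (simp add: c_def mult_ac)
  have "\<tau> \<noteq> 0" using step \<alpha> by auto
  then have \<tau>: "0 < \<tau>" "\<tau> \<le> 1" using assms(10) by auto
  \<comment> \<open>A positive real quotient forces \<open>L\<close> to be a positive real: division by \<open>\<infinity>\<close>, \<open>-\<infinity>\<close> or \<open>0\<close>
    gives \<open>0\<close>, \<open>0\<close> or \<open>\<infinity>\<close>.\<close>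
  have L: "L = ereal l" "l \<noteq> 0" and "\<tau> = \<mu> / l"
  proof -
    have "L \<noteq> \<infinity>" "L \<noteq> - \<infinity>" using assms(9) \<open>\<tau> \<noteq> 0\<close> by auto
    then show "L = ereal l" by (cases L) (auto simp: l_def)
    then show "l \<noteq> 0" using assms(9) \<mu> by (auto simp: divide_ereal_def zero_ereal_def)
    then show "\<tau> = \<mu> / l" using assms(9) \<open>L = ereal l\<close> by simp
  qed
  then have l: "l > 0" using \<tau>(1) \<mu> by (simp add: zero_less_divide_iff)
  have "\<mu> \<le> l" using \<open>\<tau> = \<mu> / l\<close> \<tau>(2) l by simp

  have floor: "2 * \<alpha>\<^sup>2 + (\<alpha> / \<tau>)\<^sup>2 < c\<^sup>2"
    using noise_floor_in_tube[OF \<tau>(1) _ step] \<alpha> by simp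
  have small: "\<alpha> * \<rho> * l \<le> \<mu>\<^sup>2"
  proof -
    have "(\<alpha> / \<tau>)\<^sup>2 \<le> c\<^sup>2" using floor zero_le_power2[of \<alpha>] by linarith
    then have "\<alpha> / \<tau> \<le> c" using c(1) by (metis less_imp_le power2_le_imp_le)
    then have "\<alpha> * l / \<mu> \<le> \<mu> / \<rho>" using c(2) \<open>\<tau> = \<mu> / l\<close> by simp
    then show ?thesis using \<mu> \<rho> by (simp add: field_simps power2_eq_square)
  qed
  have s: "0 < s" "s \<le> \<alpha> / \<tau>"
  proof -
    have r: "sqrt (\<mu>\<^sup>2 - \<alpha> * \<rho> * l) \<ge> 0" using small by simp
    then have "\<mu> + sqrt (\<mu>\<^sup>2 - \<alpha> * \<rho> * l) > 0" using \<mu> by linarith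
    then show "0 < s" using \<alpha> l by (simp add: s_def)
    have "s \<le> \<alpha> * l / \<mu>"
      unfolding s_def using r \<alpha> l \<mu> by (intro frac_le) auto
    then show "s \<le> \<alpha> / \<tau>" using \<open>\<tau> = \<mu> / l\<close> by simp
  qed
  have fixed: "\<rho> * s\<^sup>2 - 2 * \<mu> * s + \<alpha> * l = 0"
    using fixed_point_equation[OF \<mu> small s_def] .
  have Estar: "Estar = s\<^sup>2" using assms(17) by (simp add: s_def l_def)

  have x0: "x 0 \<in> X" "infdist (x 0) ?M < c"
    using assms(14) by (auto simp: tube_def c_def)
  have "E 0 \<ge> 0" by (simp add: assms(16))
  have D2: "D\<^sup>2 = max (E 0) (2 * \<alpha>\<^sup>2 + s\<^sup>2)"
    using \<open>E 0 \<ge> 0\<close> by (simp add: assms(18) Estar)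
  have D: "0 < D" "D \<le> c"
  proof -
    have "2 * \<alpha>\<^sup>2 + s\<^sup>2 > 0" using \<alpha> by (simp add: add_pos_nonneg)
    then show "0 < D" by (simp add: assms(18) Estar)
    have "s\<^sup>2 \<le> (\<alpha> / \<tau>)\<^sup>2" using s by (intro power_mono) auto
    then have "2 * \<alpha>\<^sup>2 + s\<^sup>2 \<le> c\<^sup>2" using floor by linarith
    moreover have "E 0 \<le> c\<^sup>2" unfolding assms(16)
      using x0(2) by (intro power_mono infdist_nonneg) auto
    ultimately have "D\<^sup>2 \<le> c\<^sup>2" by (simp add: D2)
    then show "D \<le> c" using c(1) by (metis less_imp_le power2_le_imp_le)
  qed
  then have D_tube: "D < \<mu> / \<rho>" using c(2) by simp

  have q: "0 < q" "q < 1"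
  proof -
    have qeq: "q = 1 + \<alpha> / l * (\<rho> - \<mu> / D)" using assms(19) by (simp add: l_def)
    have "\<rho> < \<mu> / D" using D(1) D_tube \<rho> by (simp add: field_simps)
    then have "\<alpha> / l * (\<rho> - \<mu> / D) < 0"
      using \<alpha> l by (intro mult_pos_neg) auto
    then show "q < 1" by (simp add: qeq)
    \<comment> \<open>Positivity comes from \<open>\<alpha> < D\<close> and \<open>\<mu> \<le> l\<close>, which give \<open>\<alpha> \<mu> / (l D) < 1\<close>.\<close>
    have "\<alpha>\<^sup>2 < D\<^sup>2"
    proof -
      have "\<alpha>\<^sup>2 > 0" using \<alpha> by simp
      then have "\<alpha>\<^sup>2 < 2 * \<alpha>\<^sup>2 + s\<^sup>2" using zero_le_power2[of s] by linarith
      then show ?thesis by (simp add: D2)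
    qed
    then have "\<alpha> < D" using D(1) by (metis less_imp_le power2_less_imp_less)
    then have "\<alpha> * \<mu> < D * l"
      using \<open>\<mu> \<le> l\<close> \<mu> \<alpha> by (intro mult_less_le_imp_less) auto
    then have "\<alpha> / l * (\<mu> / D) < 1" using D(1) l by (simp add: field_simps)
    moreover have "\<alpha> / l * \<rho> > 0" using \<alpha> l \<rho> by simp
    ultimately show "0 < q" by (simp add: qeq right_diff_distrib)
  qed

  have inv: "x k \<in> X \<and> E k - s\<^sup>2 \<le> max (q ^ k * (E 0 - s\<^sup>2)) (2 * \<alpha>\<^sup>2) \<and> sqrt (E k) \<le> D"
    if "generated \<zeta> k" for k
    using that
  proof (induction k)
    case 0
    have "sqrt (E 0) \<le> D" by (simp add: assms(18))
    then show ?case using x0(1) by simp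
  next
    case (Suc k)
    have gen: "generated \<zeta> k" "\<zeta> k \<noteq> 0" using Suc.prems by (auto simp: generated_def)
    note IH = Suc.IH[OF gen(1)]
    define d where "d = infdist (x k) ?M"
    have d: "0 \<le> d" "E k = d\<^sup>2" by (auto simp: d_def assms(16) infdist_nonneg)
    then have "d \<le> D" using IH by simp
    then have "d < \<mu> / \<rho>" using D_tube by simp
    have sub: "\<zeta> k \<in> subdifferential g (x k)"
      and next_x: "x (Suc k) = closest_point X (x k - \<alpha> *\<^sub>R (\<zeta> k /\<^sub>R norm (\<zeta> k)))"
      using assms(15) gen by (auto simp: subgradient_method_def)
    have "x k \<in> tube g X \<mu> \<rho> 1"
      using IH \<open>d < \<mu> / \<rho>\<close> by (simp add: tube_def d_def)
    then have "ereal (norm (\<zeta> k)) \<le> L"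
      unfolding assms(8) subgradient_bound_def using sub by (intro Sup_upper) auto
    then have "norm (\<zeta> k) \<le> l" by (simp add: L)
    have "\<rho> * d \<le> 2 * \<mu>"
    proof -
      have "\<rho> * d < \<mu>" using \<open>d < \<mu> / \<rho>\<close> \<rho> by (simp add: field_simps)
      then show ?thesis using \<mu> by simp
    qed
    with subgradient_step_distance[of \<rho> \<alpha> l g X \<mu> "x k" "\<zeta> k" d]
    have rec: "E (Suc k) \<le> d\<^sup>2 + \<alpha>\<^sup>2 - 2 * \<alpha> / l * (\<mu> * d - \<rho> / 2 * d\<^sup>2)"
      using assms(3-7) \<rho> \<alpha> l IH sub gen(2) \<open>norm (\<zeta> k) \<le> l\<close>
      by (simp add: d_def assms(16) next_x)
    have decay: "E (Suc k) - s\<^sup>2 \<le> max (q ^ Suc k * (E 0 - s\<^sup>2)) (2 * \<alpha>\<^sup>2)"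
    proof (cases "s \<le> d")
      case True
      have "E (Suc k) - s\<^sup>2 \<le> q * (E k - s\<^sup>2)"
        using recursion_contracts[OF fixed _ _ l s(1) True \<open>d \<le> D\<close>, of q] rec \<mu> \<alpha> assms(19) d(2)
        by (simp add: l_def)
      also have "\<dots> \<le> q * max (q ^ k * (E 0 - s\<^sup>2)) (2 * \<alpha>\<^sup>2)"
        using IH q(1) by (intro mult_left_mono) auto
      also have "\<dots> = max (q ^ Suc k * (E 0 - s\<^sup>2)) (q * (2 * \<alpha>\<^sup>2))"
        using q(1) by (simp add: max_mult_distrib_left mult_ac)
      also have "\<dots> \<le> max (q ^ Suc k * (E 0 - s\<^sup>2)) (2 * \<alpha>\<^sup>2)"
        using q mult_right_mono[of q 1 "2 * \<alpha>\<^sup>2"] by (intro max.mono) auto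
      finally show ?thesis .
    next
      case False
      then have "E (Suc k) \<le> s\<^sup>2 + \<alpha>\<^sup>2"
        using recursion_below_fixed_point[OF fixed _ _ l d(1)] rec \<rho> \<alpha> by fastforce
      then have "E (Suc k) - s\<^sup>2 \<le> 2 * \<alpha>\<^sup>2" using zero_le_power2[of \<alpha>] by linarith
      then show ?thesis by simp
    qed
    have "sqrt (E (Suc k)) \<le> D"
    proof -
      \<comment> \<open>If \<open>E 0 < s^2\<close> the first term of the maximum is negative, otherwise it is at most
        \<open>E 0 - s^2\<close>.\<close>
      have "q ^ Suc k * (E 0 - s\<^sup>2) \<le> max (E 0 - s\<^sup>2) (2 * \<alpha>\<^sup>2)"
      proof (cases "E 0 \<ge> s\<^sup>2")
        case True
        have "q ^ Suc k \<le> 1" using q by (intro power_le_one) auto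
        then show ?thesis using True mult_right_mono[of "q ^ Suc k" 1 "E 0 - s\<^sup>2"] by simp
      next
        case False
        have "q ^ Suc k > 0" using q(1) by simp
        then have "q ^ Suc k * (E 0 - s\<^sup>2) < 0" using False by (intro mult_pos_neg) auto
        then show ?thesis using zero_le_power2[of \<alpha>] by linarith
      qed
      then have "E (Suc k) \<le> D\<^sup>2" using decay unfolding D2 by linarith
      then show ?thesis using D(1) by (simp add: real_sqrt_le_iff real_le_lsqrt)
    qed
    moreover have "x (Suc k) \<in> X"
      unfolding next_x using assms(4) x0(1) by (intro closest_point_in_set) auto
    ultimately show ?case using decay by blast
  qed
  show ?thesis
    using q D(2) inv by (auto simp: c_def Estar)
qed

end
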